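(* In the proposed spectrum sharing protocol with users entering and leaving the network (defined in the context), each user's average throughput converges to its minimum throughput requirement in logarithmic time, even with users entering and leaving the network: for each user $i$, the distance $$\Big|(1-\delta)\sum_{\tau=0}^t\delta^\tau r_i^\tau-R_i^{\min}\Big|$$ between its average throughput at time $t$ and its minimum throughput requirement decreases exponentially with $t$ (so that the time needed to reach a distance $\epsilon$ is $O(\log(1/\epsilon))$), where $r_i^\tau$ is user $i$'s (expected) throughput in slot $\tau$ (with time counted from user $i$'s entry, and for as long as user $i$ is in the network).
   Context: Network: users share one channel. The gain from user $i$'s transmitter to user $j$'s receiver is $g_{ij}$, and the noise power at receiver $i$ is $\sigma_i^2$. User $i$'s power level lies in a compact set $\mathcal{P}_i\subseteq\mathbb{R}_+$ containing $0$. User $i$'s throughput is $r_i(\bm{p})=\log_2\big(1+\frac{p_ig_{ii}}{\sum_{j\ne i}p_jg_{ji}+\sigma_i^2}\big)$. User $i$ has minimum throughput requirement $R_i^{\min}$; all users have discount factor $\delta\in[0,1)$. $E$ is an energy efficiency criterion (a function of the users' average energy consumptions), convex and increasing in each argument. Feedback: with $I_i(\bm{p}_{-i})=\sum_{j\ne i}p_jg_{ji}+\sigma_i^2$, user $i$'s receiver observes $\hat I_i=I_i+\varepsilon_i$ ($\varepsilon_i$ random with density $f_{\varepsilon_i}$); its distress signal is $y_i=1$ if $\hat I_i>\theta_i$ and $0$ otherwise, so $\rho_i(y_i=1|\bm{p})=\int_{x>\theta_i-I_i(\bm{p}_{-i})}f_{\varepsilon_i}(x)dx$. The system distress signal is $y=1$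 if some $j$ with $p_j>0$ has $y_j=1$, and $y=0$ otherwise; $\rho(y=0|\bm{p})=\prod_{j:p_j>0}\rho_j(y_j=0|\bm{p})$. Epoch data. Suppose $K$ users are present with throughput targets $\gamma_i$. For an instantaneous throughput vector $\{r_i\}$ let $\bm{\tilde p}^i$ be the power profile in which user $i$ uses power $(2^{r_i}-1)\sigma_i^2/g_{ii}$ and all others use $0$; put $$b_{ij}=\sup_{p_j\in\mathcal{P}_j,\,p_j\ne\tilde p_j^i}\frac{\rho(y=1|\bm{\tilde p}^i)-\rho(y=1|p_j,\bm{\tilde p}^i_{-j})}{r_j(p_j,\bm{\tilde p}^i_{-j})/r_j},\quad \underline\mu_i=\max_{j\ne i}\frac{1-\rho(y=1|\bm{\tilde p}^i)}{-b_{ij}},$$ $$\underline\delta=1\Big/\Big(1+\frac{1-\sum_i\underline\mu_i}{K-1+\sum_i\sum_{j\ne i}(-\rho(y=1|\bm{\tilde p}^i)/b_{ij})}\Big).$$ The optimal instantaneous throughput vector for targets $\{\gamma_i\}$ is the minimizer of $E(\{\frac{\sigma_i^2}{g_{ii}}\frac{2^{r_i}-1}{r_i}\gamma_i\}_i)$ subject to $\sum_i\gamma_i/r_i=1$ and $0<r_i\le\gamma_i/\underline\mu_i$ (it is computed by the users with a distributed bisection algorithm called ITS). It is assumed that in each epoch this problem is feasible and $\delta\ge\underline\delta$. LDF (longest-distance-first) scheduling from slot $t_0$ with targets $\gamma_j$ and instantaneous throughputs $r_j^*$ (constants above computed at $r_j=r_j^*$): set $r_j'(t_0)=\gamma_j/r_j^*$.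 In each slot $t\ge t_0$ compute $$d_j(t)=\frac{r_j'(t)-\underline\mu_j}{1-r_j'(t)+\sum_{k\ne j}(-\rho(y=1|\bm{\tilde p}^j)/b_{jk})};$$ the user $i^*=\arg\max_jd_j(t)$ transmits at power $(2^{r_{i^*}^*}-1)\sigma_{i^*}^2/g_{i^*i^*}$ and all others are silent. If $y^t=0$, set $r_{i^*}'(t+1)=\frac1\delta r_{i^*}'(t)-(\frac1\delta-1)\big(1+\sum_{j\ne i^*}\frac{\rho(y=1|\bm{\tilde p}^{i^*})}{-b_{i^*j}}\big)$ and $r_j'(t+1)=\frac1\delta r_j'(t)+(\frac1\delta-1)\frac{\rho(y=1|\bm{\tilde p}^{i^*})}{-b_{i^*j}}$ for $j\ne i^*$. If $y^t=1$, set $r_{i^*}'(t+1)=\frac1\delta r_{i^*}'(t)-(\frac1\delta-1)\big(1-\sum_{j\ne i^*}\frac{\rho(y=0|\bm{\tilde p}^{i^*})}{-b_{i^*j}}\big)$ and $r_j'(t+1)=\frac1\delta r_j'(t)-(\frac1\delta-1)\frac{\rho(y=0|\bm{\tilde p}^{i^*})}{-b_{i^*j}}$ for $j\ne i^*$. The continuation throughput of user $j$ at time $t$ (its discounted average throughput still to be achieved from slot $t$ on) is $\gamma_j(t)=r_j'(t)\,r_j^*$. Protocol with entry and exit: time is divided into epochs $k=0,1,2,\ldots$, with epoch $k$ starting at $t_k$, $t_0=0$; a new epoch begins whenever users enter or leave. In epoch $0$ the users compute the optimal instantaneous throughputs $r_i^{(0)}$ for the targets $R_i^{\min}$ and run LDF.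 At the start $t_k$ of each epoch $k\ge1$, the users present recompute the optimal instantaneous throughputs $r_i^{(k)}$, using as target the continuation throughput $\gamma_i(t_k)$ for each user already in the network and $R_j^{\min}$ for each newly entered user $j$; they then run LDF from slot $t_k$ with these targets and instantaneous throughputs until the next epoch begins.
   Formalization: The lower bound is taken as μ_i = max_{j≠i} (1−ρ(y=1|p̃^j))/(−b_ji), with the transmitter as first index, since with the printed (1−ρ(y=1|p̃^i))/(−b_ij) the claim fails; candidate throughputs are those whose transmit powers lie in P_i. *)

theory Defs
  imports "HOL-Probability.Probability"
begin

section \<open>The network\<close>

text \<open>Users are the elements of a type \<open>'u\<close>; at any time only a finite set \<open>N\<close> of them is present.
  \<open>gain W i j\<close> is the gain from the transmitter of \<open>i\<close> to the receiver of \<open>j\<close>, and \<open>noise W i\<close> is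
  the noise power (the square of the noise standard deviation).\<close>

record 'u network =
  gain :: "'u \<Rightarrow> 'u \<Rightarrow> real"
  noise :: "'u \<Rightarrow> real"
  powers :: "'u \<Rightarrow> real set"
  threshold :: "'u \<Rightarrow> real"
  err_density :: "'u \<Rightarrow> real \<Rightarrow> real"
  min_rate :: "'u \<Rightarrow> real"

definition valid_network :: "'u network \<Rightarrow> bool" where
  "valid_network W \<longleftrightarrow>
     (\<forall>i j. 0 \<le> gain W i j) \<and> (\<forall>i. 0 < gain W i i) \<and> (\<forall>i. 0 < noise W i) \<and>
     (\<forall>i. compact (powers W i) \<and> powers W i \<subseteq> {0..} \<and> 0 \<in> powers W i) \<and>
     (\<forall>i. (\<forall>x. 0 \<le> err_density W i x) \<and> integrable lborel (err_density W i) \<and>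
          integral\<^sup>L lborel (err_density W i) = 1)"

definition interference :: "'u network \<Rightarrow> 'u set \<Rightarrow> ('u \<Rightarrow> real) \<Rightarrow> 'u \<Rightarrow> real" where
  "interference W N p i = (\<Sum>j\<in>N - {i}. p j * gain W j i) + noise W i"

definition throughput :: "'u network \<Rightarrow> 'u set \<Rightarrow> ('u \<Rightarrow> real) \<Rightarrow> 'u \<Rightarrow> real" where
  "throughput W N p i = log 2 (1 + p i * gain W i i / interference W N p i)"

text \<open>Probability that the receiver of \<open>i\<close> sends a distress signal, and probabilities of the two
  values of the system distress signal.\<close>

definition user_distress :: "'u network \<Rightarrow> 'u set \<Rightarrow> ('u \<Rightarrow> real) \<Rightarrow> 'u \<Rightarrow> real" where
  "user_distress W N p i =
     (LINT x:{x. x > threshold W i - interference W N p i}|lborel. err_density W i x)"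

definition no_distress :: "'u network \<Rightarrow> 'u set \<Rightarrow> ('u \<Rightarrow> real) \<Rightarrow> real" where
  "no_distress W N p = (\<Prod>j\<in>{j \<in> N. 0 < p j}. 1 - user_distress W N p j)"

definition distress :: "'u network \<Rightarrow> 'u set \<Rightarrow> ('u \<Rightarrow> real) \<Rightarrow> real" where
  "distress W N p = 1 - no_distress W N p"

text \<open>The criterion is given for every set of present users. It is only required to be convex in
  each argument separately, which covers jointly convex criteria.\<close>

definition energy_criterion :: "('u set \<Rightarrow> ('u \<Rightarrow> real) \<Rightarrow> real) \<Rightarrow> bool" where
  "energy_criterion E \<longleftrightarrow>
     (\<forall>N. finite N \<longrightarrow>
        (\<forall>e e'. (\<forall>i\<in>N. e i = e' i) \<longrightarrow> E N e = E N e') \<and>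
        (\<forall>e. (\<forall>i\<in>N. 0 \<le> e i) \<longrightarrow>
           (\<forall>i\<in>N. mono_on {0..} (\<lambda>x. E N (e(i := x))) \<and> convex_on {0..} (\<lambda>x. E N (e(i := x))))))"


section \<open>The constants of an epoch\<close>

definition tx_power :: "'u network \<Rightarrow> ('u \<Rightarrow> real) \<Rightarrow> 'u \<Rightarrow> real" where
  "tx_power W r i = (2 powr r i - 1) * noise W i / gain W i i"

definition solo :: "'u network \<Rightarrow> ('u \<Rightarrow> real) \<Rightarrow> 'u \<Rightarrow> 'u \<Rightarrow> real" where
  "solo W r i = (\<lambda>j. if j = i then tx_power W r i else 0)"

definition dev_benefit :: "'u network \<Rightarrow> 'u set \<Rightarrow> ('u \<Rightarrow> real) \<Rightarrow> 'u \<Rightarrow> 'u \<Rightarrow> real" where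
  "dev_benefit W N r i j =
     (SUP q \<in> powers W j - {solo W r i j}.
        (distress W N (solo W r i) - distress W N ((solo W r i)(j := q))) /
        (throughput W N ((solo W r i)(j := q)) j / r j))"

text \<open>The lower bound on the share of user \<open>i\<close>. When another user \<open>j\<close> transmits and a distress
  signal occurs, the scheduling rule below lowers the share of \<open>i\<close> by a multiple of
  \<open>no_distress W N (solo W r j) / (- dev_benefit W N r j i)\<close>, and \<open>share_bound W N r i\<close> is the
  largest of these quantities. The transmitting user is thus the first index of
  \<open>dev_benefit\<close> and the maximum is over the transmitter; with the two indices exchanged, shares
  above their bounds would not stay above them. A single user has no lower bound, written as 0.\<close>

definition share_bound :: "'u network \<Rightarrow> 'u set \<Rightarrow> ('u \<Rightarrow> real) \<Rightarrow> 'u \<Rightarrow> real" where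
  "share_bound W N r i =
     (if N - {i} = {} then 0
      else Max ((\<lambda>j. (1 - distress W N (solo W r j)) / (- dev_benefit W N r j i)) ` (N - {i})))"

text \<open>\<open>D\<close> vanishes if there is a single user; the fraction by \<open>D\<close> is then infinite and the bound on
  the discount factor is 0.\<close>

definition delta_bound :: "'u network \<Rightarrow> 'u set \<Rightarrow> ('u \<Rightarrow> real) \<Rightarrow> real" where
  "delta_bound W N r =
     (let D = real (card N) - 1 +
              (\<Sum>i\<in>N. \<Sum>j\<in>N - {i}. - distress W N (solo W r i) / dev_benefit W N r i j)
      in if D = 0 then 0 else 1 / (1 + (1 - (\<Sum>i\<in>N. share_bound W N r i)) / D))"

text \<open>Candidates are throughput vectors whose solo profiles are power profiles (the powers are
  available to the users) and for which the constants are defined (\<open>dev_benefit\<close> is never positive,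
  and it is divided by). The constraint \<open>r i \<le> \<gamma> i / share_bound W N r i\<close> is written as a product,
  so that it is no constraint when the bound is 0.\<close>

definition feasible_rates :: "'u network \<Rightarrow> 'u set \<Rightarrow> ('u \<Rightarrow> real) \<Rightarrow> ('u \<Rightarrow> real) \<Rightarrow> bool" where
  "feasible_rates W N \<gamma> r \<longleftrightarrow>
     (\<forall>i\<in>N. 0 < r i \<and> tx_power W r i \<in> powers W i) \<and>
     (\<forall>i\<in>N. \<forall>j\<in>N - {i}. dev_benefit W N r i j < 0) \<and>
     (\<Sum>i\<in>N. \<gamma> i / r i) = 1 \<and>
     (\<forall>i\<in>N. r i * share_bound W N r i \<le> \<gamma> i)"

definition optimal_rates ::
  "'u network \<Rightarrow> ('u set \<Rightarrow> ('u \<Rightarrow> real) \<Rightarrow> real) \<Rightarrow> 'u set \<Rightarrow> ('u \<Rightarrow> real) \<Rightarrow> ('u \<Rightarrow> real) \<Rightarrow> bool" where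
  "optimal_rates W E N \<gamma> =
     is_arg_min (\<lambda>r. E N (\<lambda>i. noise W i / gain W i i * ((2 powr r i - 1) / r i) * \<gamma> i))
       (feasible_rates W N \<gamma>)"


section \<open>Longest-distance-first scheduling\<close>

definition ldf_distance :: "'u network \<Rightarrow> 'u set \<Rightarrow> ('u \<Rightarrow> real) \<Rightarrow> ('u \<Rightarrow> real) \<Rightarrow> 'u \<Rightarrow> real" where
  "ldf_distance W N r x j =
     (x j - share_bound W N r j) /
     (1 - x j + (\<Sum>k\<in>N - {j}. - distress W N (solo W r j) / dev_benefit W N r j k))"

text \<open>\<open>ldf_update W \<delta> N r a y x\<close> is the vector of shares after a slot in which \<open>a\<close> transmitted and
  the distress signal was \<open>y\<close> (\<open>True\<close> for distress).\<close>

definition ldf_update ::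
  "'u network \<Rightarrow> real \<Rightarrow> 'u set \<Rightarrow> ('u \<Rightarrow> real) \<Rightarrow> 'u \<Rightarrow> bool \<Rightarrow> ('u \<Rightarrow> real) \<Rightarrow> 'u \<Rightarrow> real" where
  "ldf_update W \<delta> N r a y x j =
     (let \<rho>1 = distress W N (solo W r a);
          \<rho>0 = no_distress W N (solo W r a);
          b = dev_benefit W N r a
      in if \<not> y then
           (if j = a
            then 1 / \<delta> * x j - (1 / \<delta> - 1) * (1 + (\<Sum>k\<in>N - {a}. \<rho>1 / (- b k)))
            else 1 / \<delta> * x j + (1 / \<delta> - 1) * (\<rho>1 / (- b j)))
         else
           (if j = a
            then 1 / \<delta> * x j - (1 / \<delta> - 1) * (1 - (\<Sum>k\<in>N - {a}. \<rho>0 / (- b k)))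
            else 1 / \<delta> * x j - (1 / \<delta> - 1) * (\<rho>0 / (- b j))))"


section \<open>The protocol with entry and exit\<close>

text \<open>\<open>N t\<close> is the set of users present in slot \<open>t\<close>, so that the epochs are the maximal intervals on
  which \<open>N\<close> is constant. A history is the list of the past distress signals, latest first; the
  history before slot \<open>t\<close> has length \<open>t\<close>. A run of the protocol is described by functions of the
  history before a slot: \<open>S h\<close> are the instantaneous throughputs and \<open>act h\<close> is the transmitting user
  in this slot.\<close>

definition epoch_start :: "(nat \<Rightarrow> 'u set) \<Rightarrow> nat \<Rightarrow> bool" where
  "epoch_start N t \<longleftrightarrow> t = 0 \<or> N t \<noteq> N (t - 1)"

definition enters :: "(nat \<Rightarrow> 'u set) \<Rightarrow> 'u \<Rightarrow> nat \<Rightarrow> bool" where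
  "enters N i s \<longleftrightarrow> i \<in> N s \<and> (s = 0 \<or> i \<notin> N (s - 1))"

text \<open>\<open>cont_rate W \<delta> N S act h\<close> is the vector of continuation throughputs before slot \<open>length h\<close>, with
  the minimum requirement for users who were not present in the previous slot; these are the targets
  if an epoch starts in this slot. The share of \<open>j\<close> is the quotient \<open>cont_rate W \<delta> N S act h j / S h j\<close>:
  this is the initial value at the start of an epoch, and within an epoch it is the share computed by
  \<open>ldf_update\<close>, as \<open>S\<close> does not change.\<close>

primrec cont_rate ::
  "'u network \<Rightarrow> real \<Rightarrow> (nat \<Rightarrow> 'u set) \<Rightarrow> (bool list \<Rightarrow> 'u \<Rightarrow> real) \<Rightarrow> (bool list \<Rightarrow> 'u) \<Rightarrow>
   bool list \<Rightarrow> 'u \<Rightarrow> real" where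
  "cont_rate W \<delta> N S act [] = min_rate W"
| "cont_rate W \<delta> N S act (y # h) =
     (\<lambda>j. if j \<in> N (length h)
          then ldf_update W \<delta> (N (length h)) (S h) (act h) y
                 (\<lambda>k. cont_rate W \<delta> N S act h k / S h k) j * S h j
          else min_rate W j)"

definition share ::
  "'u network \<Rightarrow> real \<Rightarrow> (nat \<Rightarrow> 'u set) \<Rightarrow> (bool list \<Rightarrow> 'u \<Rightarrow> real) \<Rightarrow> (bool list \<Rightarrow> 'u) \<Rightarrow>
   bool list \<Rightarrow> 'u \<Rightarrow> real" where
  "share W \<delta> N S act h j = cont_rate W \<delta> N S act h j / S h j"

text \<open>The distribution of the history before slot \<open>t\<close>: given the power profile, the distress signal
  of a slot is independent of the past.\<close>

primrec history_law ::
  "'u network \<Rightarrow> (nat \<Rightarrow> 'u set) \<Rightarrow> (bool list \<Rightarrow> 'u \<Rightarrow> real) \<Rightarrow> (bool list \<Rightarrow> 'u) \<Rightarrow>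
   nat \<Rightarrow> bool list pmf" where
  "history_law W N S act 0 = return_pmf []"
| "history_law W N S act (Suc t) =
     bind_pmf (history_law W N S act t)
       (\<lambda>h. map_pmf (\<lambda>y. y # h) (bernoulli_pmf (distress W (N t) (solo W (S h) (act h)))))"

text \<open>The requirements are imposed only on histories that occur with positive probability, and only
  while some user is present. Ties in the scheduling rule and between optimal vectors may be broken
  in any way. The first requirement contains the feasibility of the problem of each epoch.\<close>

definition protocol_run ::
  "'u network \<Rightarrow> ('u set \<Rightarrow> ('u \<Rightarrow> real) \<Rightarrow> real) \<Rightarrow> real \<Rightarrow> (nat \<Rightarrow> 'u set) \<Rightarrow>
   (bool list \<Rightarrow> 'u \<Rightarrow> real) \<Rightarrow> (bool list \<Rightarrow> 'u) \<Rightarrow> bool" where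
  "protocol_run W E \<delta> N S act \<longleftrightarrow>
     (\<forall>t. \<forall>h \<in> set_pmf (history_law W N S act t). N t \<noteq> {} \<longrightarrow>
        (if epoch_start N t
         then optimal_rates W E (N t) (cont_rate W \<delta> N S act h) (S h) \<and>
              delta_bound W (N t) (S h) \<le> \<delta>
         else (\<forall>i\<in>N t. S h i = S (tl h) i)) \<and>
        is_arg_max (ldf_distance W (N t) (S h) (share W \<delta> N S act h)) (\<lambda>j. j \<in> N t) (act h))"

definition expected_throughput ::
  "'u network \<Rightarrow> (nat \<Rightarrow> 'u set) \<Rightarrow> (bool list \<Rightarrow> 'u \<Rightarrow> real) \<Rightarrow> (bool list \<Rightarrow> 'u) \<Rightarrow>
   nat \<Rightarrow> 'u \<Rightarrow> real" where
  "expected_throughput W N S act t i =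
     measure_pmf.expectation (history_law W N S act t)
       (\<lambda>h. throughput W (N t) (solo W (S h) (act h)) i)"

text \<open>Distance between the average throughput of \<open>i\<close> and its requirement, \<open>t\<close> slots after its entry
  in slot \<open>s\<close>.\<close>

definition rate_distance ::
  "'u network \<Rightarrow> real \<Rightarrow> (nat \<Rightarrow> 'u set) \<Rightarrow> (bool list \<Rightarrow> 'u \<Rightarrow> real) \<Rightarrow> (bool list \<Rightarrow> 'u) \<Rightarrow>
   'u \<Rightarrow> nat \<Rightarrow> nat \<Rightarrow> real" where
  "rate_distance W \<delta> N S act i s t =
     \<bar>(1 - \<delta>) * (\<Sum>\<tau>\<le>t. \<delta> ^ \<tau> * expected_throughput W N S act (s + \<tau>) i) - min_rate W i\<bar>"

end

theory Submission
  imports Defs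
begin

text \<open>Given the past, the expectation of the updated continuation throughput of a user is
  \<open>\<gamma> / \<delta> - (1 / \<delta> - 1) r\<close>, where \<open>\<gamma>\<close> is the present continuation throughput and \<open>r\<close> the throughput
  in this slot. Telescoping, the distance to the requirement after \<open>t\<close> slots is \<open>\<delta> ^ (t + 1)\<close> times
  the expected continuation throughput, and it remains to bound the latter. This holds because the
  shares always sum to 1 and stay above their lower bounds: the user with the longest distance has
  a distance of at least \<open>(1 - \<Sum>i. share_bound i) / D\<close> (a mediant), which is exactly what
  \<open>delta_bound \<le> \<delta>\<close> needs for the share of the transmitting user. The new targets at an entry or exit
  do not disturb this, as feasibility restores the bounds on the shares.\<close>

section \<open>Distress probabilities\<close>

lemma user_distress_bounds:
  assumes "valid_network W"
  shows "0 \<le> user_distress W N p i" and "user_distress W N p i \<le> 1"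
proof -
  have f: "\<And>x. 0 \<le> err_density W i x" "integrable lborel (err_density W i)"
    "integral\<^sup>L lborel (err_density W i) = 1"
    using assms unfolding valid_network_def by auto
  define A where "A = {x. x > threshold W i - interference W N p i}"
  have ind: "integrable lborel (\<lambda>x. indicator A x *\<^sub>R err_density W i x)"
    by (rule integrable_mult_indicator) (use f in \<open>auto simp: A_def\<close>)
  show "0 \<le> user_distress W N p i"
    unfolding user_distress_def set_lebesgue_integral_def
    by (rule integral_nonneg_AE) (use f in auto)
  have "integral\<^sup>L lborel (\<lambda>x. indicator A x *\<^sub>R err_density W i x)
      \<le> integral\<^sup>L lborel (err_density W i)"
    by (rule integral_mono[OF ind f(2)]) (use f in \<open>auto simp: indicator_def\<close>)
  then show "user_distress W N p i \<le> 1"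
    unfolding user_distress_def set_lebesgue_integral_def A_def using f(3) by simp
qed

lemma no_distress_bounds:
  assumes "valid_network W"
  shows "0 \<le> no_distress W N p" and "no_distress W N p \<le> 1"
  unfolding no_distress_def
  using user_distress_bounds[OF assms] by (auto intro!: prod_nonneg prod_le_1)

lemma distress_bounds:
  assumes "valid_network W"
  shows "0 \<le> distress W N p" and "distress W N p \<le> 1"
  using no_distress_bounds[OF assms] unfolding distress_def by auto

section \<open>Throughput of a sole transmitter\<close>

text \<open>With all others silent the interference is the noise alone, and \<open>tx_power\<close>
  inverts the throughput formula in that case.\<close>

lemma throughput_solo:
  assumes "valid_network W"
  shows "throughput W N (solo W r a) j = (if j = a then r a else 0)"
proof -
  have "0 < gain W a a" "0 < noise W a"
    using assms unfolding valid_network_def by auto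
  then show ?thesis
    by (auto simp: throughput_def interference_def solo_def tx_power_def intro!: sum.neutral)
qed

text \<open>Follows from \<open>2 powr x\<close> \<ge> \<open>1 + x * ln 2\<close>. A cap on the
  power thus caps the rate by a constant that does not depend on the run.\<close>

lemma rate_le:
  assumes "valid_network W" and "tx_power W r i \<le> P"
  shows "r i \<le> P * gain W i i / (noise W i * ln 2)"
proof -
  have pos: "0 < gain W i i" "0 < noise W i"
    using assms(1) unfolding valid_network_def by auto
  have "1 + r i * ln 2 \<le> 2 powr r i"
    using exp_ge_add_one_self[of "r i * ln 2"] by (simp add: powr_def)
  moreover have "2 powr r i - 1 \<le> P * gain W i i / noise W i"
    using assms(2) pos unfolding tx_power_def by (simp add: field_simps)
  ultimately have "r i * ln 2 \<le> P * gain W i i / noise W i" by linarith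
  then show ?thesis using pos by (simp add: field_simps)
qed


section \<open>Shares within an epoch\<close>

lemma solo_cong: "r a = r' a \<Longrightarrow> solo W r a = solo W r' a"
  by (auto simp: solo_def tx_power_def)

text \<open>During an epoch the rates are held fixed only for the users present, so all constants
  have to be determined by these values.\<close>

lemma dev_benefit_cong: "r a = r' a \<Longrightarrow> r j = r' j \<Longrightarrow> dev_benefit W N r a j = dev_benefit W N r' a j"
  unfolding dev_benefit_def by (simp add: solo_cong[of r a r'])

lemma share_bound_cong:
  assumes "\<And>k. k \<in> N \<Longrightarrow> r k = r' k" and "j \<in> N"
  shows "share_bound W N r j = share_bound W N r' j"
proof -
  have "(\<lambda>k. (1 - distress W N (solo W r k)) / (- dev_benefit W N r k j)) ` (N - {j}) =
        (\<lambda>k. (1 - distress W N (solo W r' k)) / (- dev_benefit W N r' k j)) ` (N - {j})"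
    using assms by (intro image_cong refl) (metis DiffD1 dev_benefit_cong solo_cong)
  then show ?thesis unfolding share_bound_def by presburger
qed

lemma delta_bound_cong:
  assumes "\<And>k. k \<in> N \<Longrightarrow> r k = r' k"
  shows "delta_bound W N r = delta_bound W N r'"
proof -
  have 1: "(\<Sum>i\<in>N. \<Sum>j\<in>N - {i}. - distress W N (solo W r i) / dev_benefit W N r i j) =
        (\<Sum>i\<in>N. \<Sum>j\<in>N - {i}. - distress W N (solo W r' i) / dev_benefit W N r' i j)"
    using assms by (intro sum.cong refl) (metis DiffD1 dev_benefit_cong solo_cong)
  have 2: "(\<Sum>i\<in>N. share_bound W N r i) = (\<Sum>i\<in>N. share_bound W N r' i)"
    using assms by (intro sum.cong refl share_bound_cong) auto
  show ?thesis unfolding delta_bound_def 1 2 ..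
qed

section \<open>The invariant of an epoch\<close>

text \<open>Feasibility with a free share vector \<open>x\<close> in place of the quotients of
  targets and rates. In this form it can be carried from slot to slot while the rates stay
  fixed.\<close>

definition balanced_shares :: "'u network \<Rightarrow> 'u set \<Rightarrow> ('u \<Rightarrow> real) \<Rightarrow> ('u \<Rightarrow> real) \<Rightarrow> bool" where
  "balanced_shares W N r x \<longleftrightarrow>
     (\<forall>i\<in>N. 0 < r i \<and> tx_power W r i \<in> powers W i) \<and>
     (\<forall>i\<in>N. \<forall>j\<in>N - {i}. dev_benefit W N r i j < 0) \<and>
     (\<Sum>i\<in>N. x i) = 1 \<and> (\<forall>i\<in>N. share_bound W N r i \<le> x i)"

lemma balanced_shares_cong:
  assumes "\<And>k. k \<in> N \<Longrightarrow> r k = r' k" and "\<And>k. k \<in> N \<Longrightarrow> x k = x' k"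
    and "balanced_shares W N r x"
  shows "balanced_shares W N r' x'"
proof -
  have 1: "\<forall>i\<in>N. 0 < r' i \<and> tx_power W r' i \<in> powers W i"
    using assms(1,3) unfolding balanced_shares_def tx_power_def by auto
  have 2: "\<forall>i\<in>N. \<forall>j\<in>N - {i}. dev_benefit W N r' i j < 0"
    using assms(1,3) unfolding balanced_shares_def by (metis DiffD1 dev_benefit_cong)
  have 3: "(\<Sum>i\<in>N. x' i) = 1"
    using assms(2,3) unfolding balanced_shares_def by simp
  have 4: "\<forall>i\<in>N. share_bound W N r' i \<le> x' i"
    using assms share_bound_cong[of N r r'] unfolding balanced_shares_def by metis
  show ?thesis using 1 2 3 4 unfolding balanced_shares_def by blast
qed

lemma feasible_rates_balanced:
  assumes "feasible_rates W N \<gamma> r"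
  shows "balanced_shares W N r (\<lambda>i. \<gamma> i / r i)"
  using assms unfolding feasible_rates_def balanced_shares_def
  by (auto simp: field_simps)

text \<open>The left side is, in units of \<open>1 / \<delta> - 1\<close>, what a silent user
  \<open>j\<close> loses when \<open>a\<close> transmits and distress occurs; it is one of the terms
  of the maximum.\<close>

lemma share_bound_ge:
  assumes "finite N" and "a \<in> N" and "a \<noteq> j"
  shows "no_distress W N (solo W r a) / (- dev_benefit W N r a j) \<le> share_bound W N r j"
proof -
  have "share_bound W N r j =
      Max ((\<lambda>j'. (1 - distress W N (solo W r j')) / (- dev_benefit W N r j' j)) ` (N - {j}))"
    using assms unfolding share_bound_def by auto
  then show ?thesis
    using assms by (auto intro!: Max_ge image_eqI[of _ _ a] simp: distress_def)
qed

lemma share_bound_nonneg: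
  assumes "valid_network W" and "finite N" and "balanced_shares W N r x" and "j \<in> N"
  shows "0 \<le> share_bound W N r j"
proof (cases "N - {j} = {}")
  case True
  then show ?thesis unfolding share_bound_def by simp
next
  case False
  then obtain a where a: "a \<in> N" "a \<noteq> j" by auto
  have "dev_benefit W N r a j < 0"
    using assms(3,4) a unfolding balanced_shares_def by auto
  then have "0 \<le> no_distress W N (solo W r a) / (- dev_benefit W N r a j)"
    using no_distress_bounds(1)[OF assms(1)] by (intro divide_nonneg_pos) auto
  then show ?thesis using share_bound_ge[OF assms(2) a] by (rule order_trans)
qed

lemma balanced_shares_bounds:
  assumes "valid_network W" and "finite N" and "balanced_shares W N r x" and "j \<in> N"
  shows "0 \<le> x j" and "x j \<le> 1"
proof -
  have nn: "0 \<le> x k" if "k \<in> N" for k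
    using share_bound_nonneg[OF assms(1-3) that] assms(3) that
    unfolding balanced_shares_def by force
  then show "0 \<le> x j" using assms(4) by blast
  have "x j \<le> (\<Sum>k\<in>N. x k)"
    using assms(2,4) nn by (intro member_le_sum) auto
  then show "x j \<le> 1" using assms(3) unfolding balanced_shares_def by simp
qed

lemma sum_share_bound_le:
  assumes "balanced_shares W N r x"
  shows "(\<Sum>j\<in>N. share_bound W N r j) \<le> 1"
  using assms sum_mono[of N "share_bound W N r" x] unfolding balanced_shares_def by auto

section \<open>Longest distance and the bound on the discount factor\<close>

text \<open>In units of \<open>1 / \<delta> - 1\<close>, the total that the silent users gain in a
  slot without distress when \<open>j\<close> transmits. The same sum occurs in
  \<open>ldf_distance\<close> and in \<open>delta_bound\<close>.\<close>

definition spread :: "'u network \<Rightarrow> 'u set \<Rightarrow> ('u \<Rightarrow> real) \<Rightarrow> 'u \<Rightarrow> real" where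
  "spread W N r j = (\<Sum>k\<in>N - {j}. - distress W N (solo W r j) / dev_benefit W N r j k)"

lemma spread_nonneg:
  assumes "valid_network W" and "balanced_shares W N r x" and "j \<in> N"
  shows "0 \<le> spread W N r j"
  unfolding spread_def
proof (rule sum_nonneg)
  fix k assume "k \<in> N - {j}"
  then have "dev_benefit W N r j k < 0"
    using assms(2,3) unfolding balanced_shares_def by auto
  then show "0 \<le> - distress W N (solo W r j) / dev_benefit W N r j k"
    using distress_bounds(1)[OF assms(1)] by (intro divide_nonpos_neg) auto
qed

text \<open>If the denominator of the distance of \<open>j\<close> vanished, then \<open>j\<close> would hold the whole share, so that
  the other bounds would be 0, and \<open>j\<close> would never cause distress; but the absence of distress makes the
  bounds of the others positive. Hence the junk value \<open>x / 0 = 0\<close> does not mislead the scheduler.\<close>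

lemma ldf_denominator_pos:
  assumes "valid_network W" and "finite N" and bal: "balanced_shares W N r x"
    and j: "j \<in> N" and k: "k \<in> N" "k \<noteq> j"
  shows "0 < 1 - x j + spread W N r j"
proof (rule ccontr)
  assume "\<not> ?thesis"
  then have xj: "x j = 1" and sp: "spread W N r j = 0"
    using spread_nonneg[OF assms(1) bal j] balanced_shares_bounds[OF assms(1-3) j] by auto
  have b: "dev_benefit W N r j l < 0" if "l \<in> N - {j}" for l
    using bal j that unfolding balanced_shares_def by auto
  have "0 \<le> - distress W N (solo W r j) / dev_benefit W N r j l" if "l \<in> N - {j}" for l
    using b[OF that] distress_bounds(1)[OF assms(1)] by (intro divide_nonpos_neg) auto
  then have "\<forall>l\<in>N - {j}. - distress W N (solo W r j) / dev_benefit W N r j l = 0"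
    using sp assms(2) unfolding spread_def by (subst (asm) sum_nonneg_eq_0_iff) auto
  then have d: "distress W N (solo W r j) = 0" using k b by force
  have "x j + x k \<le> (\<Sum>l\<in>N. x l)"
    using sum_mono2[of N "{j, k}" x] assms(2) j k balanced_shares_bounds(1)[OF assms(1-3)] by auto
  then have "share_bound W N r k \<le> 0"
    using bal xj k unfolding balanced_shares_def by force
  then have "no_distress W N (solo W r j) / (- dev_benefit W N r j k) \<le> 0"
    using share_bound_ge[of N j k W r] assms(2) j k by force
  moreover have "no_distress W N (solo W r j) = 1" using d unfolding distress_def by simp
  ultimately show False using b[of k] k by (simp add: divide_le_0_iff)
qed

text \<open>The largest of several fractions with positive denominators is at least the sum of the
  numerators over the sum of the denominators. As the shares sum to 1, these sums are the two
  quantities of \<open>delta_bound\<close>; the inequality is stated multiplied out.\<close>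

lemma ldf_distance_ge_mediant:
  assumes "valid_network W" and fin: "finite N" and bal: "balanced_shares W N r x"
    and a: "is_arg_max (ldf_distance W N r x) (\<lambda>j. j \<in> N) a" and k: "k \<in> N" "k \<noteq> a"
  shows "(1 - (\<Sum>j\<in>N. share_bound W N r j)) \<le>
    ldf_distance W N r x a * (real (card N) - 1 + (\<Sum>j\<in>N. spread W N r j))"
proof -
  have aN: "a \<in> N" using a unfolding is_arg_max_def by blast
  have *: "x j - share_bound W N r j \<le> ldf_distance W N r x a * (1 - x j + spread W N r j)"
    if j: "j \<in> N" for j
  proof -
    \<comment> \<open>A second user makes the denominator positive: \<open>k\<close> if
      \<open>j = a\<close>, and \<open>a\<close> otherwise.\<close>
    obtain l where "l \<in> N" "l \<noteq> j" using aN k by metis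
    then have pos: "0 < 1 - x j + spread W N r j"
      using ldf_denominator_pos[OF assms(1) fin bal j] by blast
    have "ldf_distance W N r x j \<le> ldf_distance W N r x a"
      using a j unfolding is_arg_max_def by force
    moreover have "ldf_distance W N r x j = (x j - share_bound W N r j) / (1 - x j + spread W N r j)"
      unfolding ldf_distance_def spread_def by simp
    ultimately show ?thesis using pos by (simp add: divide_le_eq)
  qed
  have sx: "(\<Sum>j\<in>N. x j) = 1" using bal unfolding balanced_shares_def by blast
  have "(\<Sum>j\<in>N. x j - share_bound W N r j) \<le>
      (\<Sum>j\<in>N. ldf_distance W N r x a * (1 - x j + spread W N r j))"
    using * by (rule sum_mono)
  then show ?thesis
    using sx by (simp add: sum_subtractf sum.distrib flip: sum_distrib_left)
qed

lemma delta_bound_eq: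
  "delta_bound W N r =
     (let D = real (card N) - 1 + (\<Sum>j\<in>N. spread W N r j)
      in if D = 0 then 0 else 1 / (1 + (1 - (\<Sum>j\<in>N. share_bound W N r j)) / D))"
  unfolding delta_bound_def spread_def by simp

lemma card_ge_2:
  assumes "finite N" and "a \<in> N" and "k \<in> N" and "k \<noteq> a"
  shows "2 \<le> card N"
  using card_mono[of N "{a, k}"] assms by auto

text \<open>Serves to exclude a second user when the discount factor is 0.\<close>

lemma delta_bound_pos:
  assumes "valid_network W" and fin: "finite N" and bal: "balanced_shares W N r x"
    and "a \<in> N" and "k \<in> N" and "k \<noteq> a"
  shows "0 < delta_bound W N r"
proof -
  have "0 < real (card N) - 1 + (\<Sum>j\<in>N. spread W N r j)"
    using card_ge_2[OF fin assms(4-6)] sum_nonneg[of N "spread W N r"]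
      spread_nonneg[OF assms(1) bal] by force
  moreover have "0 \<le> 1 - (\<Sum>j\<in>N. share_bound W N r j)"
    using sum_share_bound_le[OF bal] by simp
  ultimately show ?thesis
    unfolding delta_bound_eq Let_def by (auto intro!: divide_pos_pos add_pos_nonneg)
qed

text \<open>Divided by \<open>\<delta>\<close>, this says that the transmitter stays above its bound
  after a slot without distress, its worst case. The mediant bound and
  \<open>delta_bound W N r\<close> \<le> \<open>\<delta>\<close> give 1 \<le>
  \<open>\<delta> * (1 + d)\<close> for the longest distance \<open>d\<close>; multiplying by the
  denominator of \<open>d\<close> yields the claim.\<close>

lemma transmitter_share:
  assumes "valid_network W" and fin: "finite N" and bal: "balanced_shares W N r x"
    and a: "is_arg_max (ldf_distance W N r x) (\<lambda>j. j \<in> N) a"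
    and \<delta>: "delta_bound W N r \<le> \<delta>" "0 < \<delta>" "\<delta> < 1"
  shows "\<delta> * share_bound W N r a \<le> x a - (1 - \<delta>) * (1 + spread W N r a)"
proof (cases "\<exists>k\<in>N. k \<noteq> a")
  case False
  have "a \<in> N" using a unfolding is_arg_max_def by blast
  with False have N: "N = {a}" by blast
  then have "share_bound W N r a = 0" and "spread W N r a = 0"
    unfolding share_bound_def spread_def by auto
  moreover have "x a = 1" using bal N unfolding balanced_shares_def by simp
  \<comment> \<open>For a sole user the claim reduces to 0 \<le> \<open>\<delta>\<close>.\<close>
  ultimately show ?thesis using \<delta>(2) by simp
next
  case True
  then obtain k where k: "k \<in> N" "k \<noteq> a" by blast
  have aN: "a \<in> N" using a unfolding is_arg_max_def by blast
  define D where "D = real (card N) - 1 + (\<Sum>j\<in>N. spread W N r j)"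
  define M where "M = 1 - (\<Sum>j\<in>N. share_bound W N r j)"
  define d where "d = ldf_distance W N r x a"
  have D: "0 < D"
    using card_ge_2[OF fin aN k] sum_nonneg[of N "spread W N r"] spread_nonneg[OF assms(1) bal]
    unfolding D_def by force
  have M: "0 \<le> M" using sum_share_bound_le[OF bal] unfolding M_def by simp
  have "M \<le> d * D"
    using ldf_distance_ge_mediant[OF assms(1) fin bal a k] unfolding M_def d_def D_def .
  then have Md: "M / D \<le> d" using D by (simp add: divide_le_eq)
  have "0 \<le> M / D" using M D by simp
  have "1 / (1 + M / D) \<le> \<delta>"
    using \<delta>(1) D unfolding delta_bound_eq Let_def D_def[symmetric] M_def[symmetric] by simp
  then have "1 \<le> \<delta> * (1 + M / D)"
    using \<open>0 \<le> M / D\<close> by (simp add: divide_le_eq split: if_splits)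
  also have "\<dots> \<le> \<delta> * (1 + d)"
    using Md \<delta>(2) by (intro mult_left_mono) auto
  finally have 1: "1 \<le> \<delta> * (1 + d)" .
  have pos: "0 < 1 - x a + spread W N r a"
    by (rule ldf_denominator_pos[OF assms(1) fin bal aN k])
  have "d = (x a - share_bound W N r a) / (1 - x a + spread W N r a)"
    unfolding d_def ldf_distance_def spread_def by simp
  then have "x a - share_bound W N r a = d * (1 - x a + spread W N r a)"
    using pos by simp
  \<comment> \<open>Denominator plus numerator of the distance: the share \<open>x a\<close>
    cancels.\<close>
  then have "(1 - x a + spread W N r a) * (1 + d) = 1 + spread W N r a - share_bound W N r a"
    by (simp add: algebra_simps)
  moreover have "(1 - x a + spread W N r a) * 1 \<le> (1 - x a + spread W N r a) * (\<delta> * (1 + d))"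
    using 1 pos by (intro mult_left_mono) auto
  ultimately have "1 - x a + spread W N r a \<le> \<delta> * (1 + spread W N r a - share_bound W N r a)"
    by (metis mult.left_commute mult.right_neutral)
  then show ?thesis by (simp add: algebra_simps)
qed

section \<open>One slot of the share update\<close>

text \<open>Since the two signal probabilities sum to 1, the distress branch is the other branch
  plus a transfer: each silent user \<open>k\<close> hands
  \<open>1 / (- dev_benefit W N r a k)\<close>, scaled by \<open>1 / \<delta> - 1\<close>, to the
  transmitter.\<close>

lemma ldf_update_transmitter:
  "ldf_update W \<delta> N r a y x a =
     1 / \<delta> * x a - (1 / \<delta> - 1) * (1 + spread W N r a
       - (if y then \<Sum>k\<in>N - {a}. 1 / (- dev_benefit W N r a k) else 0))"
proof -
  have 1: "(\<Sum>k\<in>N - {a}. distress W N (solo W r a) / (- dev_benefit W N r a k)) = spread W N r a"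
    unfolding spread_def by simp
  have 2: "(\<Sum>k\<in>N - {a}. no_distress W N (solo W r a) / (- dev_benefit W N r a k)) =
      (\<Sum>k\<in>N - {a}. 1 / (- dev_benefit W N r a k)) - spread W N r a"
    unfolding spread_def sum_subtractf[symmetric] distress_def
    by (intro sum.cong refl) (simp add: diff_divide_distrib)
  show ?thesis unfolding ldf_update_def Let_def 1 2 by simp
qed

lemma ldf_update_silent:
  assumes "j \<noteq> a"
  shows "ldf_update W \<delta> N r a y x j =
     1 / \<delta> * x j + (1 / \<delta> - 1) * (distress W N (solo W r a) / (- dev_benefit W N r a j)
       - (if y then 1 / (- dev_benefit W N r a j) else 0))"
  using assms unfolding ldf_update_def Let_def distress_def
  by (simp add: diff_divide_distrib algebra_simps)

text \<open>The transfers between transmitter and silent users cancel, leaving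
  \<open>1 / \<delta> - (1 / \<delta> - 1)\<close>.\<close>

lemma ldf_update_sum:
  assumes "finite N" and "a \<in> N" and "(\<Sum>j\<in>N. x j) = 1"
  shows "(\<Sum>j\<in>N. ldf_update W \<delta> N r a y x j) = 1"
proof -
  define V where "V = (\<Sum>k\<in>N - {a}. 1 / (- dev_benefit W N r a k))"
  have "(\<Sum>j\<in>N - {a}. ldf_update W \<delta> N r a y x j) =
      (\<Sum>j\<in>N - {a}. 1 / \<delta> * x j + (1 / \<delta> - 1) *
         (- distress W N (solo W r a) / dev_benefit W N r a j
          - (if y then 1 / (- dev_benefit W N r a j) else 0)))"
    by (intro sum.cong refl) (simp add: ldf_update_silent)
  also have "\<dots> = 1 / \<delta> * (\<Sum>j\<in>N - {a}. x j) + (1 / \<delta> - 1) * (spread W N r a - (if y then V else 0))"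
    unfolding sum.distrib sum_distrib_left[symmetric] sum_subtractf spread_def V_def by simp
  also have "(\<Sum>j\<in>N - {a}. x j) = 1 - x a"
    using assms sum.remove[of N a x] by simp
  finally have "(\<Sum>j\<in>N - {a}. ldf_update W \<delta> N r a y x j) =
      1 / \<delta> * (1 - x a) + (1 / \<delta> - 1) * (spread W N r a - (if y then V else 0))" .
  moreover have "(\<Sum>j\<in>N. ldf_update W \<delta> N r a y x j) =
      ldf_update W \<delta> N r a y x a + (\<Sum>j\<in>N - {a}. ldf_update W \<delta> N r a y x j)"
    using assms by (simp add: sum.remove)
  ultimately show ?thesis
    unfolding ldf_update_transmitter V_def[symmetric] by (simp add: algebra_simps)
qed

text \<open>The worst signals are opposite: no distress for the transmitter, covered by
  \<open>transmitter_share\<close>, and distress for a silent user, covered by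
  \<open>share_bound_ge\<close>.\<close>

lemma ldf_update_balanced:
  assumes "valid_network W" and fin: "finite N" and bal: "balanced_shares W N r x"
    and a: "is_arg_max (ldf_distance W N r x) (\<lambda>j. j \<in> N) a"
    and \<delta>: "delta_bound W N r \<le> \<delta>" "0 < \<delta>" "\<delta> < 1"
  shows "balanced_shares W N r (ldf_update W \<delta> N r a y x)"
proof -
  have aN: "a \<in> N" using a unfolding is_arg_max_def by blast
  have sx: "(\<Sum>j\<in>N. x j) = 1" using bal unfolding balanced_shares_def by blast
  have b: "dev_benefit W N r a j < 0" if "j \<in> N" "j \<noteq> a" for j
    using bal aN that unfolding balanced_shares_def by auto
  have inv: "0 < 1 / \<delta> - 1" using \<delta> by simp
  have "share_bound W N r j \<le> ldf_update W \<delta> N r a y x j" if j: "j \<in> N" for j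
  proof (cases "j = a")
    case True
    have "\<delta> * share_bound W N r a / \<delta> \<le> (x a - (1 - \<delta>) * (1 + spread W N r a)) / \<delta>"
      using transmitter_share[OF assms(1) fin bal a \<delta>] \<delta>(2) by (intro divide_right_mono) auto
    then have 1: "share_bound W N r a \<le> 1 / \<delta> * x a - (1 / \<delta> - 1) * (1 + spread W N r a)"
      using \<delta>(2) by (simp add: field_simps)
    have "0 \<le> 1 / (- dev_benefit W N r a k)" if "k \<in> N - {a}" for k
      using b[of k] that by (intro divide_nonneg_pos) auto
    then have "0 \<le> (\<Sum>k\<in>N - {a}. 1 / (- dev_benefit W N r a k))" by (rule sum_nonneg)
    \<comment> \<open>\<open>V\<close> is what distress returns to the transmitter; being
      nonnegative, it can only raise the share.\<close>
    moreover define V where "V = (if y then \<Sum>k\<in>N - {a}. 1 / (- dev_benefit W N r a k) else 0)"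
    ultimately have "0 \<le> V" by (cases y) (simp_all only: if_True if_False order_refl)
    then have "(1 / \<delta> - 1) * (1 + spread W N r a - V) \<le> (1 / \<delta> - 1) * (1 + spread W N r a)"
      using inv by (intro mult_left_mono) auto
    then show ?thesis using 1 unfolding True ldf_update_transmitter V_def[symmetric] by linarith
  next
    case False
    let ?s = "share_bound W N r j"
    let ?c = "distress W N (solo W r a) / (- dev_benefit W N r a j)
       - (if y then 1 / (- dev_benefit W N r a j) else 0)"
    have bj: "dev_benefit W N r a j < 0" using b j False by blast
    have nn: "0 \<le> ?s" by (rule share_bound_nonneg[OF assms(1) fin bal j])
    have "- ?s \<le> ?c"
    proof (cases y)
      case True
      have "?c = - (no_distress W N (solo W r a) / (- dev_benefit W N r a j))"
        using True unfolding distress_def by (simp add: diff_divide_distrib)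
      then show ?thesis using share_bound_ge[OF fin aN, of j W r] False by force
    next
      case c: False
      have "0 \<le> distress W N (solo W r a) / (- dev_benefit W N r a j)"
        using bj distress_bounds(1)[OF assms(1)] by (intro divide_nonneg_pos) auto
      then show ?thesis using c nn by simp
    qed
    \<comment> \<open>A share of at least \<open>?s\<close> grows to at least
      \<open>?s / \<delta>\<close> and loses at most \<open>(1 / \<delta> - 1) * ?s\<close>, which
      leaves \<open>?s\<close>.\<close>
    then have "(1 / \<delta> - 1) * (- ?s) \<le> (1 / \<delta> - 1) * ?c"
      using inv by (intro mult_left_mono) auto
    moreover have "1 / \<delta> * ?s \<le> 1 / \<delta> * x j"
      using bal j \<delta>(2) unfolding balanced_shares_def by (intro mult_left_mono) auto
    ultimately show ?thesis
      unfolding ldf_update_silent[OF False] by (simp add: algebra_simps)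
  qed
  then show ?thesis
    using bal ldf_update_sum[OF fin aN sx] unfolding balanced_shares_def by simp
qed

text \<open>The transfer made under distress, weighted by its probability, offsets the drift common
  to both signals. On average only the identity of the transmitter matters.\<close>

lemma ldf_update_mean:
  fixes W :: "'u network" and N r a
  defines "\<rho> \<equiv> distress W N (solo W r a)"
  shows "\<rho> * ldf_update W \<delta> N r a True x j + (1 - \<rho>) * ldf_update W \<delta> N r a False x j =
    1 / \<delta> * x j - (1 / \<delta> - 1) * (if j = a then 1 else 0)"
proof (cases "j = a")
  case True
  define V where "V = (\<Sum>k\<in>N - {a}. 1 / (- dev_benefit W N r a k))"
  define e where "e = 1 / \<delta>"
  have "spread W N r a = \<rho> * V"
    unfolding spread_def \<rho>_def V_def sum_distrib_left by simp
  then show ?thesis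
    unfolding True ldf_update_transmitter V_def[symmetric] e_def[symmetric]
    by (simp add: algebra_simps)
next
  case False
  define c where "c = 1 / (- dev_benefit W N r a j)"
  define e where "e = 1 / \<delta>"
  have "distress W N (solo W r a) / (- dev_benefit W N r a j) = \<rho> * c"
    unfolding \<rho>_def c_def by simp
  then show ?thesis
    using False unfolding ldf_update_silent[OF False] c_def[symmetric] e_def[symmetric]
    by (simp add: algebra_simps)
qed


section \<open>Runs of the protocol\<close>

lemma finite_set_history_law: "finite (set_pmf (history_law W N S act t))"
  by (induction t) auto

lemma length_history: "h \<in> set_pmf (history_law W N S act t) \<Longrightarrow> length h = t"
  by (induction t arbitrary: h) auto

lemma expectation_history_Suc:
  fixes f :: "bool list \<Rightarrow> real"
  assumes "valid_network W"
  shows "measure_pmf.expectation (history_law W N S act (Suc t)) f =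
    measure_pmf.expectation (history_law W N S act t)
      (\<lambda>h. distress W (N t) (solo W (S h) (act h)) * f (True # h)
         + (1 - distress W (N t) (solo W (S h) (act h))) * f (False # h))"
proof -
  let ?p = "history_law W N S act t"
  have "measure_pmf.expectation (history_law W N S act (Suc t)) f =
      (\<Sum>h\<in>set_pmf ?p. pmf ?p h *\<^sub>R measure_pmf.expectation
        (map_pmf (\<lambda>y. y # h) (bernoulli_pmf (distress W (N t) (solo W (S h) (act h))))) f)"
    unfolding history_law.simps
    by (rule pmf_expectation_bind) (auto simp: finite_set_history_law)
  also have "\<dots> = (\<Sum>h\<in>set_pmf ?p. pmf ?p h *\<^sub>R
      (distress W (N t) (solo W (S h) (act h)) * f (True # h)
         + (1 - distress W (N t) (solo W (S h) (act h))) * f (False # h)))"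
    \<comment> \<open>\<open>bernoulli_pmf\<close> has the intended weights only for a parameter
      between 0 and 1.\<close>
    using distress_bounds[OF assms] by (intro sum.cong refl) (simp add: algebra_simps)
  also have "\<dots> = measure_pmf.expectation ?p
      (\<lambda>h. distress W (N t) (solo W (S h) (act h)) * f (True # h)
         + (1 - distress W (N t) (solo W (S h) (act h))) * f (False # h))"
    by (rule integral_measure_pmf[symmetric]) (auto simp: finite_set_history_law set_pmf_iff)
  finally show ?thesis .
qed

lemma expectation_history_cong:
  fixes f g :: "bool list \<Rightarrow> real"
  assumes "\<And>h. h \<in> set_pmf (history_law W N S act t) \<Longrightarrow> f h = g h"
  shows "measure_pmf.expectation (history_law W N S act t) f =
    measure_pmf.expectation (history_law W N S act t) g"
  by (rule integral_cong_AE) (use assms in \<open>auto simp: AE_measure_pmf_iff\<close>)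

section \<open>The invariant along a run\<close>

lemma cont_rate_share:
  assumes "j \<in> N (length h)"
  shows "cont_rate W \<delta> N S act (y # h) j =
    ldf_update W \<delta> (N (length h)) (S h) (act h) y (share W \<delta> N S act h) j * S h j"
  using assms unfolding share_def by simp

lemma protocol_run_transmitter:
  assumes "protocol_run W E \<delta> N S act" and "h \<in> set_pmf (history_law W N S act t)"
    and "N t \<noteq> {}"
  shows "is_arg_max (ldf_distance W (N t) (S h) (share W \<delta> N S act h)) (\<lambda>j. j \<in> N t) (act h)"
  using assms unfolding protocol_run_def by blast

lemma protocol_run_rates:
  assumes "protocol_run W E \<delta> N S act" and "h \<in> set_pmf (history_law W N S act t)"
    and "N t \<noteq> {}"
  shows "if epoch_start N t
    then optimal_rates W E (N t) (cont_rate W \<delta> N S act h) (S h) \<and>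
         delta_bound W (N t) (S h) \<le> \<delta>
    else \<forall>i\<in>N t. S h i = S (tl h) i"
  using assms unfolding protocol_run_def by blast

text \<open>Optimal rates are feasible for the new targets, so the invariant is established afresh,
  whatever state the previous epoch has left.\<close>

lemma protocol_run_epoch_start:
  assumes run: "protocol_run W E \<delta> N S act" and h: "h \<in> set_pmf (history_law W N S act t)"
    and "N t \<noteq> {}" and "epoch_start N t"
  shows "balanced_shares W (N t) (S h) (share W \<delta> N S act h)"
    and "delta_bound W (N t) (S h) \<le> \<delta>"
proof -
  have "optimal_rates W E (N t) (cont_rate W \<delta> N S act h) (S h)" "delta_bound W (N t) (S h) \<le> \<delta>"
    using protocol_run_rates[OF assms(1-3)] assms(4) by simp_all
  moreover from this have "feasible_rates W (N t) (cont_rate W \<delta> N S act h) (S h)"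
    unfolding optimal_rates_def is_arg_min_def by blast
  ultimately show "balanced_shares W (N t) (S h) (share W \<delta> N S act h)"
    and "delta_bound W (N t) (S h) \<le> \<delta>"
    using feasible_rates_balanced[of W "N t" "cont_rate W \<delta> N S act h" "S h"]
    unfolding share_def[abs_def] by simp_all
qed

text \<open>Induction over slots: an epoch start establishes the invariant, and within an epoch the
  update preserves it.\<close>

lemma protocol_run_balanced:
  assumes "valid_network W" and \<delta>: "0 < \<delta>" "\<delta> < 1" and fin: "\<And>t. finite (N t)"
    and run: "protocol_run W E \<delta> N S act"
  shows "h \<in> set_pmf (history_law W N S act t) \<Longrightarrow> N t \<noteq> {} \<Longrightarrow>
    balanced_shares W (N t) (S h) (share W \<delta> N S act h) \<and> delta_bound W (N t) (S h) \<le> \<delta>"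
proof (induction t arbitrary: h)
  case 0
  then show ?case
    using protocol_run_epoch_start[OF run] unfolding epoch_start_def by blast
next
  case (Suc t)
  show ?case
  proof (cases "epoch_start N (Suc t)")
    case True
    then show ?thesis using protocol_run_epoch_start[OF run Suc.prems] by blast
  next
    case False
    then have N: "N (Suc t) = N t" unfolding epoch_start_def by simp
    from Suc.prems(1) obtain y h' where h: "h = y # h'"
      and h': "h' \<in> set_pmf (history_law W N S act t)" by auto
    have len: "length h' = t" using length_history[OF h'] .
    have S: "S h k = S h' k" if "k \<in> N t" for k
      using protocol_run_rates[OF run Suc.prems] False that N unfolding h by simp
    have IH: "balanced_shares W (N t) (S h') (share W \<delta> N S act h')"
      "delta_bound W (N t) (S h') \<le> \<delta>"
      using Suc.IH[OF h'] Suc.prems(2) N by simp_all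
    have "is_arg_max (ldf_distance W (N t) (S h') (share W \<delta> N S act h')) (\<lambda>j. j \<in> N t) (act h')"
      using protocol_run_transmitter[OF run h'] Suc.prems(2) N by simp
    note bal = ldf_update_balanced[OF assms(1) fin IH(1) this IH(2) \<delta>, of y]
    \<comment> \<open>Within an epoch the factor \<open>S h' k\<close> in the continuation
      throughput cancels against the division by the unchanged rate.\<close>
    have "share W \<delta> N S act h k =
        ldf_update W \<delta> (N t) (S h') (act h') y (share W \<delta> N S act h') k" if k: "k \<in> N t" for k
    proof -
      have "S h' k \<noteq> 0" using IH(1) k unfolding balanced_shares_def by force
      moreover have "share W \<delta> N S act h k = cont_rate W \<delta> N S act (y # h') k / S h' k"
        unfolding share_def S[OF k, symmetric] h ..
      ultimately show ?thesis using cont_rate_share[of k N h'] k len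
        by (simp del: cont_rate.simps)
    qed
    then have "balanced_shares W (N t) (S h) (share W \<delta> N S act h)"
      using bal S by (intro balanced_shares_cong[OF _ _ bal]) auto
    moreover have "delta_bound W (N t) (S h) = delta_bound W (N t) (S h')"
      using S by (intro delta_bound_cong) auto
    ultimately show ?thesis using IH(2) N by simp
  qed
qed

section \<open>Telescoping of the continuation throughputs\<close>

definition expected_cont_rate ::
  "'u network \<Rightarrow> real \<Rightarrow> (nat \<Rightarrow> 'u set) \<Rightarrow> (bool list \<Rightarrow> 'u \<Rightarrow> real) \<Rightarrow> (bool list \<Rightarrow> 'u) \<Rightarrow>
   nat \<Rightarrow> 'u \<Rightarrow> real" where
  "expected_cont_rate W \<delta> N S act t i =
     measure_pmf.expectation (history_law W N S act t) (\<lambda>h. cont_rate W \<delta> N S act h i)"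

text \<open>The recursion of a discounted average: the value now is \<open>1 - \<delta>\<close>
  times the present throughput plus \<open>\<delta>\<close> times the expected value next. It also
  holds across epoch boundaries, because the next value is formed with the rates of slot
  \<open>t\<close>, before any recomputation.\<close>

lemma expected_cont_rate_Suc:
  assumes "valid_network W" and \<delta>: "0 < \<delta>" "\<delta> < 1" and fin: "\<And>t. finite (N t)"
    and run: "protocol_run W E \<delta> N S act" and i: "i \<in> N t"
  shows "\<delta> * expected_cont_rate W \<delta> N S act (Suc t) i =
    expected_cont_rate W \<delta> N S act t i - (1 - \<delta>) * expected_throughput W N S act t i"
proof -
  let ?E = "measure_pmf.expectation (history_law W N S act t)"
  let ?c = "\<lambda>h. cont_rate W \<delta> N S act h i"
  let ?r = "\<lambda>h. throughput W (N t) (solo W (S h) (act h)) i"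
  have int: "integrable (history_law W N S act t) f" for f :: "bool list \<Rightarrow> real"
    by (rule integrable_measure_pmf_finite) (rule finite_set_history_law)
  have "expected_cont_rate W \<delta> N S act (Suc t) i = ?E (\<lambda>h. 1 / \<delta> * ?c h - (1 / \<delta> - 1) * ?r h)"
    unfolding expected_cont_rate_def expectation_history_Suc[OF assms(1)]
  proof (rule expectation_history_cong)
    fix h assume h: "h \<in> set_pmf (history_law W N S act t)"
    let ?\<rho> = "distress W (N t) (solo W (S h) (act h))"
    let ?u = "\<lambda>y. ldf_update W \<delta> (N t) (S h) (act h) y (share W \<delta> N S act h) i"
    have len: "length h = t" using length_history[OF h] .
    have "S h i \<noteq> 0"
      using protocol_run_balanced[OF assms(1) \<delta> fin run h] i unfolding balanced_shares_def by force
    then have c: "?c h = share W \<delta> N S act h i * S h i" unfolding share_def by simp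
    have "?\<rho> * ?c (True # h) + (1 - ?\<rho>) * ?c (False # h) =
        (?\<rho> * ?u True + (1 - ?\<rho>) * ?u False) * S h i"
      using cont_rate_share[of i N h] i len by (simp add: algebra_simps del: cont_rate.simps)
    also have "\<dots> = 1 / \<delta> * ?c h - (1 / \<delta> - 1) * ?r h"
      unfolding ldf_update_mean throughput_solo[OF assms(1)] c by (auto simp: algebra_simps)
    finally show "?\<rho> * ?c (True # h) + (1 - ?\<rho>) * ?c (False # h) =
      1 / \<delta> * ?c h - (1 / \<delta> - 1) * ?r h" .
  qed
  also have "\<dots> = 1 / \<delta> * ?E ?c - (1 / \<delta> - 1) * ?E ?r"
    by (simp add: int)
  finally show ?thesis
    using \<delta>(1) unfolding expected_cont_rate_def expected_throughput_def
    by (simp add: field_simps)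
qed

lemma discounted_throughput:
  assumes "valid_network W" and \<delta>: "0 < \<delta>" "\<delta> < 1" and fin: "\<And>t. finite (N t)"
    and run: "protocol_run W E \<delta> N S act"
  shows "(\<And>\<tau>. \<tau> \<le> t \<Longrightarrow> i \<in> N (s + \<tau>)) \<Longrightarrow>
    (1 - \<delta>) * (\<Sum>\<tau>\<le>t. \<delta> ^ \<tau> * expected_throughput W N S act (s + \<tau>) i) =
    expected_cont_rate W \<delta> N S act s i
      - \<delta> ^ Suc t * expected_cont_rate W \<delta> N S act (s + Suc t) i"
proof (induction t)
  case 0
  then show ?case using expected_cont_rate_Suc[OF assms, of i s] by simp
next
  case (Suc t)
  have "\<delta> * expected_cont_rate W \<delta> N S act (Suc (s + Suc t)) i =
      expected_cont_rate W \<delta> N S act (s + Suc t) i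
        - (1 - \<delta>) * expected_throughput W N S act (s + Suc t) i"
    by (rule expected_cont_rate_Suc[OF assms]) (rule Suc.prems, simp)
  \<comment> \<open>The recursion, discounted to the entry slot, so that it cancels the remainder
    left by the first \<open>Suc t\<close> terms.\<close>
  then have "\<delta> ^ Suc (Suc t) * expected_cont_rate W \<delta> N S act (s + Suc (Suc t)) i =
      \<delta> ^ Suc t * (expected_cont_rate W \<delta> N S act (s + Suc t) i
        - (1 - \<delta>) * expected_throughput W N S act (s + Suc t) i)"
    by (metis add_Suc_right mult.assoc mult.commute power_Suc)
  then show ?case using Suc by (simp add: algebra_simps)
qed

lemma cont_rate_entry:
  assumes "enters N i s" and "h \<in> set_pmf (history_law W N S act s)"
  shows "cont_rate W \<delta> N S act h i = min_rate W i"
proof (cases h)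
  case (Cons y h')
  \<comment> \<open>The latest signal belongs to slot \<open>s - 1\<close>, where \<open>i\<close>
    was absent, so the default branch of \<open>cont_rate\<close> applies; a returning user starts
    anew.\<close>
  then have "length h' = s - 1" "s \<noteq> 0" using length_history[OF assms(2)] by auto
  then show ?thesis using assms(1) Cons unfolding enters_def by simp
qed simp

lemma expected_cont_rate_entry:
  assumes "enters N i s"
  shows "expected_cont_rate W \<delta> N S act s i = min_rate W i"
proof -
  have "expected_cont_rate W \<delta> N S act s i =
      measure_pmf.expectation (history_law W N S act s) (\<lambda>h. min_rate W i)"
    unfolding expected_cont_rate_def
    by (rule expectation_history_cong) (rule cont_rate_entry[OF assms])
  then show ?thesis by simp
qed

text \<open>After slot \<open>t\<close> the value is an updated share in [0, 1] times the rate used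
  in slot \<open>t\<close>. Presence in slot \<open>t\<close> therefore suffices, even if the user
  leaves in the next one.\<close>

lemma expected_cont_rate_bounds:
  assumes "valid_network W" and \<delta>: "0 < \<delta>" "\<delta> < 1" and fin: "\<And>t. finite (N t)"
    and run: "protocol_run W E \<delta> N S act" and i: "i \<in> N t"
    and R: "\<forall>r. tx_power W r i \<in> powers W i \<longrightarrow> r i \<le> R"
  shows "\<bar>expected_cont_rate W \<delta> N S act (Suc t) i\<bar> \<le> R"
proof -
  have "\<bar>cont_rate W \<delta> N S act h i\<bar> \<le> R"
    if h: "h \<in> set_pmf (history_law W N S act (Suc t))" for h
  proof -
    from h obtain y h' where h_eq: "h = y # h'"
      and h': "h' \<in> set_pmf (history_law W N S act t)" by auto
    let ?x = "ldf_update W \<delta> (N t) (S h') (act h') y (share W \<delta> N S act h')"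
    have len: "length h' = t" using length_history[OF h'] .
    have ne: "N t \<noteq> {}" using i by blast
    note bal = protocol_run_balanced[OF assms(1) \<delta> fin run h' ne]
    have "balanced_shares W (N t) (S h') ?x"
      using bal protocol_run_transmitter[OF run h' ne] ldf_update_balanced[OF assms(1) fin] \<delta>
      by blast
    then have x: "0 \<le> ?x i" "?x i \<le> 1" and r: "0 < S h' i" "S h' i \<le> R"
      using balanced_shares_bounds[OF assms(1) fin _ i] R i unfolding balanced_shares_def by blast+
    have "?x i * S h' i \<le> 1 * S h' i" using x(2) r(1) by (intro mult_right_mono) auto
    then have "?x i * S h' i \<le> R" using r(2) by linarith
    moreover have "0 \<le> ?x i * S h' i" using x(1) r(1) by simp
    ultimately show ?thesis
      using cont_rate_share[of i N h'] i len unfolding h_eq by (simp del: cont_rate.simps)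
  qed
  then have "AE h in history_law W N S act (Suc t). \<bar>cont_rate W \<delta> N S act h i\<bar> \<le> R"
    unfolding AE_measure_pmf_iff by blast
  then have "measure_pmf.expectation (history_law W N S act (Suc t))
      (\<lambda>h. \<bar>cont_rate W \<delta> N S act h i\<bar>) \<le> R"
    by (intro measure_pmf.integral_le_const integrable_measure_pmf_finite finite_set_history_law)
  with integral_abs_bound show ?thesis
    unfolding expected_cont_rate_def by (rule order_trans)
qed

text \<open>The telescoped sum starts from the minimum requirement, so the distance is exactly the
  discounted expected continuation throughput.\<close>

lemma rate_distance_le:
  assumes "valid_network W" and \<delta>: "0 < \<delta>" "\<delta> < 1" and fin: "\<And>t. finite (N t)"
    and run: "protocol_run W E \<delta> N S act"
    and "enters N i s" and i: "\<And>\<tau>. \<tau> \<le> t \<Longrightarrow> i \<in> N (s + \<tau>)"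
    and R: "\<forall>r. tx_power W r i \<in> powers W i \<longrightarrow> r i \<le> R"
  shows "rate_distance W \<delta> N S act i s t \<le> R * \<delta> ^ Suc t"
proof -
  have "(1 - \<delta>) * (\<Sum>\<tau>\<le>t. \<delta> ^ \<tau> * expected_throughput W N S act (s + \<tau>) i) =
      min_rate W i - \<delta> ^ Suc t * expected_cont_rate W \<delta> N S act (s + Suc t) i"
    using discounted_throughput[OF assms(1) \<delta> fin run, of t i s] i
      expected_cont_rate_entry[OF assms(6)] by simp
  then have "rate_distance W \<delta> N S act i s t =
      \<delta> ^ Suc t * \<bar>expected_cont_rate W \<delta> N S act (s + Suc t) i\<bar>"
    unfolding rate_distance_def using \<delta> by (simp add: abs_mult)
  moreover have "\<bar>expected_cont_rate W \<delta> N S act (Suc (s + t)) i\<bar> \<le> R"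
    by (rule expected_cont_rate_bounds[where N = N, OF assms(1) \<delta> fin run i[OF order_refl] R])
  ultimately show ?thesis using \<delta> by (simp add: mult.commute mult_left_mono)
qed

text \<open>With \<open>\<delta> = 0\<close> the condition \<open>delta_bound \<le> \<delta>\<close> only leaves epochs with a single user, who meets the
  requirement in the first slot.\<close>

lemma rate_distance_delta_0:
  assumes "valid_network W" and fin: "\<And>t. finite (N t)"
    and run: "protocol_run W E 0 N S act" and ent: "enters N i s"
  shows "rate_distance W 0 N S act i s t = 0"
proof -
  \<comment> \<open>An entry changes the set of present users, so it starts an epoch.\<close>
  have i: "i \<in> N s" and start: "epoch_start N s"
    using ent unfolding enters_def epoch_start_def by auto
  have "throughput W (N s) (solo W (S h) (act h)) i = min_rate W i"
    if h: "h \<in> set_pmf (history_law W N S act s)" for h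
  proof -
    have ne: "N s \<noteq> {}" using i by blast
    note bal = protocol_run_epoch_start[OF run h ne start]
    have single: "k = i" if "k \<in> N s" for k
      using delta_bound_pos[OF assms(1) fin bal(1) i that] bal(2) by (meson leD)
    then have N: "N s = {i}" using i by blast
    have "act h = i"
      using protocol_run_transmitter[OF run h ne] single unfolding is_arg_max_def by blast
    moreover have "share W 0 N S act h i = 1"
      using bal(1) unfolding balanced_shares_def N by simp
    then have "S h i = min_rate W i"
      unfolding share_def cont_rate_entry[OF ent h] by (simp add: divide_eq_1_iff)
    ultimately show ?thesis unfolding throughput_solo[OF assms(1)] by simp
  qed
  then have "expected_throughput W N S act s i =
      measure_pmf.expectation (history_law W N S act s) (\<lambda>h. min_rate W i)"
    unfolding expected_throughput_def by (rule expectation_history_cong)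
  moreover have "(\<Sum>\<tau>\<le>t. 0 ^ \<tau> * expected_throughput W N S act (s + \<tau>) i) =
      expected_throughput W N S act s i"
    \<comment> \<open>As \<open>0 ^ 0 = 1\<close>, exactly the entry slot contributes.\<close>
    by (subst sum.remove[of _ 0]) (auto intro!: sum.neutral)
  ultimately show ?thesis unfolding rate_distance_def by simp
qed

section \<open>Exponential decay and logarithmic time\<close>

text \<open>\<open>C\<close> and \<open>q\<close> are obtained before the run is given: the compact
  power set bounds the rates of \<open>i\<close> in all runs at once.\<close>

lemma rate_distance_exponential:
  assumes "valid_network W" and "0 \<le> \<delta>" and "\<delta> < 1"
  obtains C q where "1 \<le> C" and "0 < q" and "q < 1"
    and "\<And>N S act s t. (\<And>\<tau>. finite (N \<tau>)) \<Longrightarrow> protocol_run W E \<delta> N S act \<Longrightarrow> enters N i s \<Longrightarrow>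
      (\<And>\<tau>. \<tau> \<le> t \<Longrightarrow> i \<in> N (s + \<tau>)) \<Longrightarrow> rate_distance W \<delta> N S act i s t \<le> C * q ^ t"
proof (cases "\<delta> = 0")
  case True
  show ?thesis
    \<comment> \<open>The distance is 0 here; \<open>1 / 2\<close> is just some ratio strictly
      between 0 and 1.\<close>
    by (rule that[of 1 "1 / 2"]) (use rate_distance_delta_0[OF assms(1)] True in auto)
next
  case False
  then have \<delta>: "0 < \<delta>" using assms(2) by simp
  have "bounded (powers W i)"
    using assms(1) unfolding valid_network_def by (blast intro: compact_imp_bounded)
  then obtain P where P: "\<And>p. p \<in> powers W i \<Longrightarrow> p \<le> P"
    unfolding bounded_iff real_norm_def by (meson abs_le_D1)
  \<comment> \<open>The maximum with 1 ensures 1 \<le> \<open>C\<close>, so that \<open>ln C\<close>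
    is nonnegative in the conversion to time.\<close>
  define R where "R = max 1 (P * gain W i i / (noise W i * ln 2))"
  have R: "\<forall>r. tx_power W r i \<in> powers W i \<longrightarrow> r i \<le> R"
    using rate_le[OF assms(1) P] unfolding R_def by (simp add: le_max_iff_disj)
  have "1 \<le> R" unfolding R_def by simp
  show ?thesis
  proof (rule that[OF \<open>1 \<le> R\<close> \<delta> assms(3)])
    fix N S act s t
    assume *: "\<And>\<tau>. finite (N \<tau>)" "protocol_run W E \<delta> N S act" "enters N i s"
      "\<And>\<tau>. \<tau> \<le> t \<Longrightarrow> i \<in> N (s + \<tau>)"
    have "rate_distance W \<delta> N S act i s t \<le> R * \<delta> ^ Suc t"
      by (rule rate_distance_le[where N = N and s = s, OF assms(1) \<delta> assms(3) * R])
    also have "\<dots> \<le> R * \<delta> ^ t"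
      using \<open>1 \<le> R\<close> \<delta> assms(3) by (intro mult_left_mono power_decreasing) auto
    finally show "rate_distance W \<delta> N S act i s t \<le> R * \<delta> ^ t" .
  qed
qed

text \<open>Taking logarithms, \<open>t * ln (1 / q)\<close> has to exceed
  \<open>ln C + ln (1 / \<epsilon>)\<close>. As \<open>\<epsilon>\<close> \<le>
  \<open>1 / 2\<close>, the constant \<open>ln C\<close> is at most \<open>ln C / ln 2\<close> times
  \<open>ln (1 / \<epsilon>)\<close>, which explains the choice of \<open>c\<close>.\<close>

lemma exponential_imp_logarithmic_time:
  fixes C q :: real
  assumes "1 \<le> C" and "0 < q" and "q < 1"
  obtains c where "0 < c"
    and "\<And>\<epsilon> t. 0 < \<epsilon> \<Longrightarrow> \<epsilon> \<le> 1 / 2 \<Longrightarrow> c * ln (1 / \<epsilon>) \<le> real t \<Longrightarrow> C * q ^ t \<le> \<epsilon>"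
proof
  define c where "c = (ln C / ln 2 + 1) / ln (1 / q)"
  have lq: "0 < ln (1 / q)" and lC: "0 \<le> ln C" using assms by auto
  then show "0 < c" unfolding c_def by (intro divide_pos_pos add_nonneg_pos) auto
  fix \<epsilon> :: real and t :: nat
  assume \<epsilon>: "0 < \<epsilon>" "\<epsilon> \<le> 1 / 2" and t: "c * ln (1 / \<epsilon>) \<le> real t"
  have "2 \<le> 1 / \<epsilon>" using \<epsilon> by (simp add: field_simps)
  then have "ln 2 \<le> ln (1 / \<epsilon>)" using \<epsilon> by (subst ln_le_cancel_iff) auto
  then have "ln C / ln 2 * ln 2 \<le> ln C / ln 2 * ln (1 / \<epsilon>)"
    using lC by (intro mult_left_mono) auto
  then have "ln C + ln (1 / \<epsilon>) \<le> (ln C / ln 2 + 1) * ln (1 / \<epsilon>)" by (simp add: algebra_simps)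
  also have "\<dots> = c * ln (1 / \<epsilon>) * ln (1 / q)" using lq unfolding c_def by simp
  also have "\<dots> \<le> real t * ln (1 / q)" using t lq by (intro mult_right_mono) auto
  finally have "ln C + real t * ln q \<le> ln \<epsilon>" using \<epsilon> assms by (simp add: ln_div)
  moreover have "ln (C * q ^ t) = ln C + real t * ln q"
    using assms by (simp add: ln_mult ln_realpow)
  ultimately have "ln (C * q ^ t) \<le> ln \<epsilon>" by simp
  then show "C * q ^ t \<le> \<epsilon>" using \<epsilon> assms by (subst (asm) ln_le_cancel_iff) auto
qed

theorem theorem4:
  fixes W :: "'u network"
    and E :: "'u set \<Rightarrow> ('u \<Rightarrow> real) \<Rightarrow> real"
    and \<delta> :: real
    and i :: 'u
  assumes "valid_network W"
    and "energy_criterion E"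
    and "0 \<le> \<delta>" and "\<delta> < 1"
  shows "(\<exists>C q. 0 < q \<and> q < 1 \<and>
           (\<forall>N S act s t.
              (\<forall>\<tau>. finite (N \<tau>)) \<and> protocol_run W E \<delta> N S act \<and>
              enters N i s \<and> (\<forall>\<tau>\<le>t. i \<in> N (s + \<tau>)) \<longrightarrow>
              rate_distance W \<delta> N S act i s t \<le> C * q ^ t)) \<and>
         (\<exists>c. 0 < c \<and>
           (\<forall>\<epsilon> N S act s t.
              0 < \<epsilon> \<and> \<epsilon> \<le> 1 / 2 \<and>
              (\<forall>\<tau>. finite (N \<tau>)) \<and> protocol_run W E \<delta> N S act \<and>
              enters N i s \<and> (\<forall>\<tau>\<le>t. i \<in> N (s + \<tau>)) \<and> c * ln (1 / \<epsilon>) \<le> real t \<longrightarrow>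
              rate_distance W \<delta> N S act i s t \<le> \<epsilon>))"
proof -
  obtain C q where Cq: "1 \<le> C" "0 < q" "q < 1"
    and conv: "\<And>N S act s t. (\<And>\<tau>. finite (N \<tau>)) \<Longrightarrow> protocol_run W E \<delta> N S act \<Longrightarrow>
      enters N i s \<Longrightarrow> (\<And>\<tau>. \<tau> \<le> t \<Longrightarrow> i \<in> N (s + \<tau>)) \<Longrightarrow>
      rate_distance W \<delta> N S act i s t \<le> C * q ^ t"
    using rate_distance_exponential[OF assms(1,3,4)] by metis
  obtain c where c: "0 < c"
    and log: "\<And>\<epsilon> t. 0 < \<epsilon> \<Longrightarrow> \<epsilon> \<le> 1 / 2 \<Longrightarrow> c * ln (1 / \<epsilon>) \<le> real t \<Longrightarrow> C * q ^ t \<le> \<epsilon>"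
    using exponential_imp_logarithmic_time[OF Cq] by metis
  show ?thesis
  proof (rule conjI)
    show "\<exists>C q. 0 < q \<and> q < 1 \<and> (\<forall>N S act s t.
        (\<forall>\<tau>. finite (N \<tau>)) \<and> protocol_run W E \<delta> N S act \<and>
        enters N i s \<and> (\<forall>\<tau>\<le>t. i \<in> N (s + \<tau>)) \<longrightarrow>
        rate_distance W \<delta> N S act i s t \<le> C * q ^ t)"
      using Cq(2,3) conv by (intro exI[of _ C] exI[of _ q]) simp
    show "\<exists>c. 0 < c \<and> (\<forall>\<epsilon> N S act s t.
        0 < \<epsilon> \<and> \<epsilon> \<le> 1 / 2 \<and>
        (\<forall>\<tau>. finite (N \<tau>)) \<and> protocol_run W E \<delta> N S act \<and>
        enters N i s \<and> (\<forall>\<tau>\<le>t. i \<in> N (s + \<tau>)) \<and> c * ln (1 / \<epsilon>) \<le> real t \<longrightarrow>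
        rate_distance W \<delta> N S act i s t \<le> \<epsilon>)"
    proof (intro exI[of _ c] conjI c allI impI)
      fix \<epsilon> N S act s and t :: nat
      assume *: "0 < \<epsilon> \<and> \<epsilon> \<le> 1 / 2 \<and>
        (\<forall>\<tau>. finite (N \<tau>)) \<and> protocol_run W E \<delta> N S act \<and>
        enters N i s \<and> (\<forall>\<tau>\<le>t. i \<in> N (s + \<tau>)) \<and> c * ln (1 / \<epsilon>) \<le> real t"
      have "rate_distance W \<delta> N S act i s t \<le> C * q ^ t" by (rule conv) (use * in auto)
      also have "\<dots> \<le> \<epsilon>" by (rule log) (use * in auto)
      finally show "rate_distance W \<delta> N S act i s t \<le> \<epsilon>" .
    qed
  qed
qed

end
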